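(* Let $X$ be an almost surely bounded real random variable. If $X$ is strictly sub-Gaussian, then the third and fourth cumulants of $X$ satisfy $$\kappa_3=\mathbb{E}[(X-\mathbb{E}[X])^3]=0\quad\text{and}\quad \kappa_4=\mathbb{E}[(X-\mathbb{E}[X])^4]-3\,\mathbb{V}[X]^2\le 0.$$
   Context: A random variable $X$ with finite mean $\mu=\mathbb{E}[X]$ is $\sigma^2$-sub-Gaussian, with proxy variance $\sigma^2>0$, if $\mathbb{E}[\exp(\lambda(X-\mu))]\le \exp(\lambda^2\sigma^2/2)$ for all $\lambda\in\mathbb{R}$. The smallest such $\sigma^2$ is the optimal proxy variance $\sigma_{\mathrm{opt}}^2(X)$. One says that $X$ is strictly sub-Gaussian if $\sigma_{\mathrm{opt}}^2(X)=\mathbb{V}[X]$, where $\mathbb{V}[X]$ is the variance of $X$. *)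

theory Defs
  imports "HOL-Probability.Probability"
begin

context prob_space
begin

text \<open>
  The integrability of the exponential is part of the hypothesis: the Bochner integral of a
  non-integrable function is 0, so that without it the inequality would hold whenever the
  moment generating function is infinite.
\<close>

definition sub_gaussian :: "real \<Rightarrow> ('a \<Rightarrow> real) \<Rightarrow> bool" where
  "sub_gaussian s X \<longleftrightarrow>
     s > 0 \<and> integrable M X \<and>
     (\<forall>l::real. integrable M (\<lambda>x. exp (l * (X x - expectation X))) \<and>
        expectation (\<lambda>x. exp (l * (X x - expectation X))) \<le> exp (l\<^sup>2 * s / 2))"

text \<open>
  The parameter \<open>s\<close> above stands for the proxy variance, i.e. for sigma squared. The least proxy
  variance is written as an infimum, which agrees with the minimum whenever there is one
  (lemmas below). For an almost surely constant variable every \<open>s > 0\<close> is a proxy variance, there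
  is no smallest one, and the infimum gives the value 0, which is the variance.
\<close>

definition optimal_proxy_variance :: "('a \<Rightarrow> real) \<Rightarrow> real" where
  "optimal_proxy_variance X = Inf {s. sub_gaussian s X}"

definition strictly_sub_gaussian :: "('a \<Rightarrow> real) \<Rightarrow> bool" where
  "strictly_sub_gaussian X \<longleftrightarrow>
     (\<exists>s. sub_gaussian s X) \<and> optimal_proxy_variance X = variance X"

lemma optimal_proxy_variance_eq_minimum:
  assumes "sub_gaussian s X" and "\<And>t. sub_gaussian t X \<Longrightarrow> s \<le> t"
  shows "optimal_proxy_variance X = s"
  unfolding optimal_proxy_variance_def using assms by (intro cInf_eq_minimum) auto

lemma optimal_proxy_variance_attained:
  assumes sg: "sub_gaussian s X" and pos: "optimal_proxy_variance X > 0"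
  shows "sub_gaussian (optimal_proxy_variance X) X"
proof -
  define v where "v = optimal_proxy_variance X"
  have "expectation (\<lambda>x. exp (l * (X x - expectation X))) \<le> exp (l\<^sup>2 * v / 2)" for l :: real
  proof (rule tendsto_lowerbound[where F = "at_right v" and f = "\<lambda>t. exp (l\<^sup>2 * t / 2)"])
    show "((\<lambda>t. exp (l\<^sup>2 * t / 2)) \<longlongrightarrow> exp (l\<^sup>2 * v / 2)) (at_right v)"
      by (intro tendsto_intros) simp_all
    show "\<forall>\<^sub>F t in at_right v.
        expectation (\<lambda>x. exp (l * (X x - expectation X))) \<le> exp (l\<^sup>2 * t / 2)"
    proof (rule eventually_at_rightI[of v "v + 1"])
      fix t assume "t \<in> {v<..<v + 1}"
      then have "Inf {s. sub_gaussian s X} < t"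
        by (simp add: v_def optimal_proxy_variance_def)
      then obtain u where u: "sub_gaussian u X" "u < t"
        using cInf_lessD[of "{s. sub_gaussian s X}" t] sg by auto
      have "expectation (\<lambda>x. exp (l * (X x - expectation X))) \<le> exp (l\<^sup>2 * u / 2)"
        using u(1) by (simp add: sub_gaussian_def)
      also have "\<dots> \<le> exp (l\<^sup>2 * t / 2)"
        using u(2) by (simp add: mult_left_mono)
      finally show "expectation (\<lambda>x. exp (l * (X x - expectation X))) \<le> exp (l\<^sup>2 * t / 2)" .
    qed simp
  qed simp
  then show ?thesis
    using sg pos by (simp add: sub_gaussian_def v_def)
qed

text \<open>
  Cumulants as derivatives at 0 of the cumulant generating function. This is meaningful for
  variables whose moment generating function is finite near 0, in particular for bounded ones.
\<close>

definition cumulant :: "nat \<Rightarrow> ('a \<Rightarrow> real) \<Rightarrow> real" where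
  "cumulant n X = (deriv ^^ n) (\<lambda>t. ln (expectation (\<lambda>x. exp (t * X x)))) 0"

end

end

theory Submission
  imports Defs
begin

text \<open>
  Put \<open>\<mu> = E[X]\<close>, \<open>Y = X - \<mu>\<close>, \<open>v = V[X]\<close>, and let \<open>K(t) = ln E[exp (t Y)]\<close> be the cumulant
  generating function of the centred variable. Strict sub-Gaussianity says that the optimal proxy
  variance is \<open>v\<close>, so that \<open>g(t) = v t\<^sup>2 / 2 - K(t)\<close> is nonnegative for all \<open>t\<close>.
  The parabola is the second-order Taylor polynomial of \<open>K\<close> at 0, because \<open>K(0) = K'(0) = 0\<close> and
  \<open>K''(0) = v\<close>. Hence \<open>g\<close> vanishes to second order at 0, and its next coefficients are those of
  \<open>-K\<close>: the third derivative at 0 is \<open>-\<kappa>\<^sub>3\<close> and the fourth is \<open>-\<kappa>\<^sub>4\<close>. A nonnegative function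
  cannot start with an odd power of \<open>t\<close>, since that would change sign, so \<open>\<kappa>\<^sub>3 = 0\<close>; then it starts
  with \<open>-\<kappa>\<^sub>4 t\<^sup>4 / 24\<close>, which forces \<open>\<kappa>\<^sub>4 \<le> 0\<close>. This sign argument is
  \<open>leading_derivative_nonneg_on_ray\<close>.

  The analytic work is to differentiate \<open>K\<close> four times. For bounded \<open>Y\<close> one may differentiate under
  the expectation, so \<open>E[Y\<^sup>k exp (t Y)]\<close> has derivative \<open>E[Y\<^sup>k\<^sup>+\<^sup>1 exp (t Y)]\<close>
  (\<open>tilted_moment_has_derivative\<close>). The normalised quotients \<open>r\<^sub>k = E[Y\<^sup>k exp (t Y)] / E[exp (t Y)]\<close>
  therefore satisfy the closed system \<open>r\<^sub>k' = r\<^sub>k\<^sub>+\<^sub>1 - r\<^sub>k r\<^sub>1\<close> (\<open>tilted_mean_has_derivative\<close>), and since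
  \<open>K' = r\<^sub>1\<close>, every derivative of \<open>K\<close> is a polynomial in them. At \<open>t = 0\<close> the \<open>r\<^sub>k\<close> are the moments
  of \<open>Y\<close>, with \<open>r\<^sub>1 = 0\<close>. Finally, the cumulant generating function of \<open>X\<close> is \<open>t \<mu> + K(t)\<close>, and the
  linear term is gone after two derivatives, so \<open>X\<close> has the same third and fourth cumulants as \<open>Y\<close>.
\<close>

section \<open>Sign of the first nonvanishing derivative\<close>

text \<open>
  By Taylor with Lagrange remainder, \<open>D 0 (h s) = D n \<xi> (h s)\<^sup>n / n!\<close> for some \<open>\<xi>\<close> between 0 and
  \<open>h s\<close>; let \<open>h\<close> decrease to 0. The number \<open>s\<close> chooses the side from which 0 is approached: for odd
  \<open>n\<close> the choices 1 and -1 together give \<open>D n 0 = 0\<close>.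
\<close>

lemma leading_derivative_nonneg_on_ray:
  fixes D :: "nat \<Rightarrow> real \<Rightarrow> real"
  assumes deriv: "\<And>m t. m < n \<Longrightarrow> (D m has_real_derivative D (Suc m) t) (at t)"
    and zero: "\<And>m. m < n \<Longrightarrow> D m 0 = 0"
    and nonneg: "\<And>t. 0 \<le> D 0 t"
    and cont: "isCont (D n) 0"
  shows "0 \<le> D n 0 * s ^ n"
proof -
  have "\<exists>\<xi>. \<bar>\<xi>\<bar> \<le> \<bar>h * s\<bar> \<and> 0 \<le> D n \<xi> * s ^ n" if "0 < h" for h
  proof -
    obtain \<xi> where \<xi>: "\<bar>\<xi>\<bar> \<le> \<bar>h * s\<bar>"
      "D 0 (h * s) = (\<Sum>m<n. D m 0 / fact m * (h * s) ^ m) + D n \<xi> / fact n * (h * s) ^ n"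
      using Maclaurin_bi_le[of D "D 0" n "h * s"] deriv by auto
    have "0 \<le> D n \<xi> / fact n * (h * s) ^ n"
      using \<xi>(2) nonneg[of "h * s"] zero by simp
    also have "\<dots> = (D n \<xi> * s ^ n) * (h ^ n / fact n)"
      by (simp add: power_mult_distrib)
    finally have "0 \<le> (D n \<xi> * s ^ n) * (h ^ n / fact n)" .
    moreover have "0 < h ^ n / fact n"
      using that by simp
    ultimately have "0 \<le> D n \<xi> * s ^ n"
      by (metis mult_neg_pos not_le)
    with \<xi>(1) show ?thesis by blast
  qed
  then have "\<forall>i. \<exists>\<xi>. \<bar>\<xi>\<bar> \<le> \<bar>inverse (real (Suc i)) * s\<bar> \<and> 0 \<le> D n \<xi> * s ^ n"
    by auto
  then obtain \<xi> where \<xi>: "\<And>i. \<bar>\<xi> i\<bar> \<le> \<bar>inverse (real (Suc i)) * s\<bar>"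
      "\<And>i. 0 \<le> D n (\<xi> i) * s ^ n"
    by metis
  have "(\<lambda>i. \<bar>inverse (real (Suc i)) * s\<bar>) \<longlonglongrightarrow> 0"
    using tendsto_rabs_zero[OF tendsto_mult_left_zero[OF LIMSEQ_inverse_real_of_nat]] .
  then have "\<xi> \<longlonglongrightarrow> 0"
    by (rule Lim_null_comparison[rotated]) (use \<xi>(1) in auto)
  then have "(\<lambda>i. D n (\<xi> i) * s ^ n) \<longlonglongrightarrow> D n 0 * s ^ n"
    by (intro tendsto_mult tendsto_const isCont_tendsto_compose[OF cont])
  then show ?thesis
    by (rule LIMSEQ_le_const) (use \<xi>(2) in auto)
qed

section \<open>Differentiating the cumulant generating function of a bounded variable\<close>

lemma exp_taylor2_bound:
  fixes u :: real
  shows "\<bar>exp u - 1 - u\<bar> \<le> exp \<bar>u\<bar> * u\<^sup>2"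
proof -
  obtain \<xi> where \<xi>: "\<bar>\<xi>\<bar> \<le> \<bar>u\<bar>"
    "exp u = (\<Sum>m<2. u ^ m / fact m) + exp \<xi> / fact 2 * u\<^sup>2"
    using Maclaurin_exp_le by blast
  then have "\<bar>exp u - 1 - u\<bar> = exp \<xi> * u\<^sup>2 / 2"
    by (simp add: numeral_2_eq_2 abs_mult)
  also have "\<dots> \<le> exp \<xi> * u\<^sup>2"
    by simp
  also have "\<dots> \<le> exp \<bar>u\<bar> * u\<^sup>2"
    using \<xi>(1) by (intro mult_right_mono) auto
  finally show ?thesis .
qed

locale bounded_random_variable = prob_space +
  fixes Y :: "'a \<Rightarrow> real" and C :: real
  assumes measurable_Y [measurable]: "Y \<in> borel_measurable M"
    and bounded_Y: "AE x in M. \<bar>Y x\<bar> \<le> C"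
begin

definition tilted_moment :: "nat \<Rightarrow> real \<Rightarrow> real" where
  "tilted_moment k t = expectation (\<lambda>x. Y x ^ k * exp (t * Y x))"

text \<open>
  The \<open>k\<close>-th moment of \<open>Y\<close> under the exponentially tilted (Esscher) measure, whose density is
  proportional to \<open>exp (t Y)\<close>.
\<close>

definition tilted_mean :: "nat \<Rightarrow> real \<Rightarrow> real" where
  "tilted_mean k t = tilted_moment k t / tilted_moment 0 t"

definition cgf :: "real \<Rightarrow> real" where
  "cgf t = ln (tilted_moment 0 t)"

lemma bound_nonneg: "0 \<le> C"
proof (rule ccontr)
  assume "\<not> 0 \<le> C"
  have "AE x in M. False"
    using bounded_Y by eventually_elim (use \<open>\<not> 0 \<le> C\<close> in linarith)
  then show False by simp
qed

lemma abs_tilted_le: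
  assumes "\<bar>y\<bar> \<le> C"
  shows "\<bar>y ^ k * exp (t * y)\<bar> \<le> C ^ k * exp (\<bar>t\<bar> * C)"
proof -
  have "\<bar>t * y\<bar> \<le> \<bar>t\<bar> * C"
    using assms by (simp add: abs_mult mult_left_mono)
  then have "exp (t * y) \<le> exp (\<bar>t\<bar> * C)"
    by simp
  moreover have "\<bar>y\<bar> ^ k \<le> C ^ k"
    using assms by (intro power_mono) auto
  ultimately have "\<bar>y\<bar> ^ k * exp (t * y) \<le> C ^ k * exp (\<bar>t\<bar> * C)"
    using bound_nonneg by (intro mult_mono) auto
  then show ?thesis
    by (simp add: abs_mult power_abs)
qed

lemma integrable_tilted: "integrable M (\<lambda>x. Y x ^ k * exp (t * Y x))"
proof (rule integrable_const_bound)
  show "AE x in M. norm (Y x ^ k * exp (t * Y x)) \<le> C ^ k * exp (\<bar>t\<bar> * C)"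
    using bounded_Y by eventually_elim (simp only: real_norm_def abs_tilted_le)
qed simp

text \<open>
  Subtracting the expected derivative from the difference quotient leaves
  \<open>E[Y\<^sup>k exp (t Y) (exp (h Y) - 1 - h Y)] / h\<close>. The last factor is of order \<open>h\<^sup>2\<close> uniformly over the
  bounded range of \<open>Y\<close>, so the error is at most a constant times \<open>|h|\<close>.
\<close>

lemma tilted_moment_has_derivative:
  "(tilted_moment k has_real_derivative tilted_moment (Suc k) t) (at t)"
proof -
  define B where "B = C ^ (k + 2) * exp (\<bar>t\<bar> * C) * exp C"
  have quot: "\<bar>(tilted_moment k (t + h) - tilted_moment k t) / h - tilted_moment (Suc k) t\<bar>
      \<le> B * \<bar>h\<bar>" if h: "h \<noteq> 0" "\<bar>h\<bar> < 1" for h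
  proof -
    let ?R = "\<lambda>x. Y x ^ k * exp (t * Y x) * (exp (h * Y x) - 1 - h * Y x)"
    have R_eq: "?R x = Y x ^ k * exp ((t + h) * Y x) - Y x ^ k * exp (t * Y x)
        - h * (Y x ^ Suc k * exp (t * Y x))" for x
      by (simp add: algebra_simps exp_add)
    have int: "integrable M ?R"
      unfolding R_eq
      by (intro Bochner_Integration.integrable_diff integrable_mult_right integrable_tilted)
    have E_eq: "expectation ?R
        = tilted_moment k (t + h) - tilted_moment k t - h * tilted_moment (Suc k) t"
      unfolding R_eq tilted_moment_def
      by (subst Bochner_Integration.integral_diff Bochner_Integration.integral_mult_right_zero;
          (intro Bochner_Integration.integrable_diff integrable_mult_right integrable_tilted)?)+
         (rule refl)
    have bound: "AE x in M. \<bar>?R x\<bar> \<le> B * h\<^sup>2"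
      using bounded_Y
    proof eventually_elim
      case (elim x)
      have "\<bar>h * Y x\<bar> \<le> 1 * C"
        unfolding abs_mult using h elim by (intro mult_mono) auto
      then have "\<bar>exp (h * Y x) - 1 - h * Y x\<bar> \<le> exp C * (h * Y x)\<^sup>2"
        by (intro order_trans[OF exp_taylor2_bound] mult_right_mono) auto
      also have "\<dots> \<le> exp C * (C\<^sup>2 * h\<^sup>2)"
        using power_mono[OF elim, of 2]
        by (auto simp: power_mult_distrib mult.commute[of "h\<^sup>2"] intro!: mult_right_mono)
      finally have "\<bar>exp (h * Y x) - 1 - h * Y x\<bar> \<le> exp C * (C\<^sup>2 * h\<^sup>2)" .
      then have "\<bar>?R x\<bar> \<le> (C ^ k * exp (\<bar>t\<bar> * C)) * (exp C * (C\<^sup>2 * h\<^sup>2))"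
        unfolding abs_mult[of "Y x ^ k * exp (t * Y x)"] using bound_nonneg
        by (intro mult_mono abs_tilted_le elim) auto
      then show ?case
        by (simp add: B_def power_add mult_ac power2_eq_square)
    qed
    have "\<bar>expectation ?R\<bar> \<le> expectation (\<lambda>x. \<bar>?R x\<bar>)"
      by (rule integral_abs_bound)
    also have "\<dots> \<le> B * h\<^sup>2"
      by (rule integral_le_const) (use int bound in auto)
    finally have "\<bar>expectation ?R\<bar> / \<bar>h\<bar> \<le> B * \<bar>h\<bar>"
      using h by (simp add: divide_le_eq power2_eq_square abs_mult[symmetric] flip: mult.assoc)
    then have "\<bar>expectation ?R / h\<bar> \<le> B * \<bar>h\<bar>"
      by simp
    moreover have "expectation ?R / h
        = (tilted_moment k (t + h) - tilted_moment k t) / h - tilted_moment (Suc k) t"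
      unfolding E_eq using h by (simp add: diff_divide_distrib)
    ultimately show ?thesis by metis
  qed
  have "((\<lambda>h. (tilted_moment k (t + h) - tilted_moment k t) / h - tilted_moment (Suc k) t)
      \<longlongrightarrow> 0) (at 0)"
  proof (rule Lim_null_comparison)
    show "\<forall>\<^sub>F h in at 0. norm ((tilted_moment k (t + h) - tilted_moment k t) / h
        - tilted_moment (Suc k) t) \<le> B * \<bar>h\<bar>"
      unfolding eventually_at using quot by (intro exI[of _ 1]) (auto simp: dist_norm)
    have "((\<lambda>h. B * \<bar>h\<bar>) \<longlongrightarrow> B * \<bar>0\<bar>) (at (0::real))"
      by (intro tendsto_intros)
    then show "((\<lambda>h. B * \<bar>h\<bar>) \<longlongrightarrow> 0) (at (0::real))" by simp
  qed
  then show ?thesis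
    unfolding DERIV_def by (rule LIM_zero_cancel)
qed

lemma tilted_moment_0_pos: "0 < tilted_moment 0 t"
proof -
  have "exp (- (\<bar>t\<bar> * C)) \<le> tilted_moment 0 t"
    unfolding tilted_moment_def
  proof (rule integral_ge_const[OF integrable_tilted])
    show "AE x in M. exp (- (\<bar>t\<bar> * C)) \<le> Y x ^ 0 * exp (t * Y x)"
      using bounded_Y
    proof eventually_elim
      case (elim x)
      have "\<bar>t * Y x\<bar> \<le> \<bar>t\<bar> * C"
        using elim by (simp add: abs_mult mult_left_mono)
      then show ?case by auto
    qed
  qed
  then show ?thesis
    using exp_gt_zero[of "- (\<bar>t\<bar> * C)"] by linarith
qed

text \<open>
  The quotient rule; the second factor \<open>tilted_mean 1\<close> is the logarithmic derivative of the
  normalising constant. The chain-rule form makes the lemma usable as a derivative rule, and so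
  reduces the higher derivatives of \<open>cgf\<close> to routine computation.
\<close>

lemma tilted_mean_has_derivative [derivative_intros]:
  assumes "(f has_real_derivative f') (at t)"
  shows "((\<lambda>t. tilted_mean k (f t)) has_real_derivative
     (tilted_mean (Suc k) (f t) - tilted_mean k (f t) * tilted_mean 1 (f t)) * f') (at t)"
proof -
  have "(tilted_mean k has_real_derivative
      (tilted_mean (Suc k) u - tilted_mean k u * tilted_mean 1 u)) (at u)" for u
  proof -
    have pos: "tilted_moment 0 u \<noteq> 0"
      using tilted_moment_0_pos[of u] by simp
    show ?thesis
      using DERIV_divide[OF tilted_moment_has_derivative[of k u]
          tilted_moment_has_derivative[of 0 u] pos] pos
      unfolding tilted_mean_def [abs_def]
      by (simp add: diff_divide_distrib)
  qed
  from DERIV_chain2[OF this assms] show ?thesis .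
qed

lemma cgf_has_derivative:
  "(cgf has_real_derivative tilted_mean 1 t) (at t)"
  using DERIV_chain2[OF DERIV_ln[OF tilted_moment_0_pos] tilted_moment_has_derivative[of 0 t]]
  unfolding cgf_def [abs_def] tilted_mean_def by (simp add: divide_inverse mult.commute)

text \<open>
  The cumulants of \<open>Y\<close> of orders 1 to 4 under the tilted measure, in terms of raw moments; only
  \<open>m \<le> 4\<close> is meaningful.
\<close>

definition cgf_deriv :: "nat \<Rightarrow> real \<Rightarrow> real" where
  "cgf_deriv m =
     (if m = 0 then cgf
      else if m = 1 then tilted_mean 1
      else if m = 2 then (\<lambda>t. tilted_mean 2 t - tilted_mean 1 t ^ 2)
      else if m = 3 then (\<lambda>t. tilted_mean 3 t - 3 * tilted_mean 1 t * tilted_mean 2 t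
        + 2 * tilted_mean 1 t ^ 3)
      else (\<lambda>t. tilted_mean 4 t - 4 * tilted_mean 1 t * tilted_mean 3 t
        - 3 * tilted_mean 2 t ^ 2 + 12 * tilted_mean 1 t ^ 2 * tilted_mean 2 t
        - 6 * tilted_mean 1 t ^ 4))"

lemma cgf_deriv_has_derivative:
  assumes "m < 4"
  shows "(cgf_deriv m has_real_derivative cgf_deriv (Suc m) t) (at t)"
proof -
  consider "m = 0" | "m = 1" | "m = 2" | "m = 3"
    using assms by linarith
  then show ?thesis
  proof cases
    case 1
    then show ?thesis
      using cgf_has_derivative by (simp add: cgf_deriv_def)
  next
    case 2
    then show ?thesis
      using tilted_mean_has_derivative[OF DERIV_ident, of 1 t]
      by (simp add: cgf_deriv_def power2_eq_square flip: numeral_2_eq_2)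
  next
    case 3
    then show ?thesis
      by (auto simp: cgf_deriv_def power2_eq_square power3_eq_cube algebra_simps
          simp flip: numeral_2_eq_2 intro!: derivative_eq_intros)
  next
    case 4
    then show ?thesis
      by (auto simp: cgf_deriv_def power2_eq_square power3_eq_cube power4_eq_xxxx algebra_simps
          simp flip: numeral_2_eq_2 intro!: derivative_eq_intros)
  qed
qed

lemma tilted_mean_0: "tilted_mean k 0 = expectation (\<lambda>x. Y x ^ k)"
  by (simp add: tilted_mean_def tilted_moment_def prob_space)

end

section \<open>Third and fourth cumulants of strictly sub-Gaussian variables\<close>

theorem proposition3p2:
  fixes M :: "'a measure" and X :: "'a \<Rightarrow> real"
  assumes "prob_space M"
    and "X \<in> borel_measurable M"
    and "\<exists>C::real. AE x in M. \<bar>X x\<bar> \<le> C"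
    and "prob_space.strictly_sub_gaussian M X"
  shows "prob_space.cumulant M 3 X
           = prob_space.expectation M (\<lambda>x. (X x - prob_space.expectation M X) ^ 3)
    \<and> prob_space.expectation M (\<lambda>x. (X x - prob_space.expectation M X) ^ 3) = 0
    \<and> prob_space.cumulant M 4 X
           = prob_space.expectation M (\<lambda>x. (X x - prob_space.expectation M X) ^ 4)
             - 3 * (prob_space.variance M X)\<^sup>2
    \<and> prob_space.expectation M (\<lambda>x. (X x - prob_space.expectation M X) ^ 4)
             - 3 * (prob_space.variance M X)\<^sup>2 \<le> 0"
proof -
  interpret prob_space M by fact
  define \<mu> where "\<mu> = expectation X"
  define Y where "Y = (\<lambda>x. X x - \<mu>)"
  define v where "v = variance X"
  note [measurable] = \<open>X \<in> borel_measurable M\<close>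
  obtain C where C: "AE x in M. \<bar>X x\<bar> \<le> C"
    using assms(3) by blast
  interpret Y: bounded_random_variable M Y "C + \<bar>\<mu>\<bar>"
  proof
    show "Y \<in> borel_measurable M" unfolding Y_def by measurable
    show "AE x in M. \<bar>Y x\<bar> \<le> C + \<bar>\<mu>\<bar>"
      using C by eventually_elim (simp add: Y_def)
  qed
  have int_X: "integrable M X"
    using C by (intro integrable_const_bound[of _ C]) auto
  have mean_0: "expectation Y = 0"
    using int_X by (simp add: Y_def \<mu>_def prob_space)
  have var: "expectation (\<lambda>x. Y x ^ 2) = v"
    by (simp add: Y_def v_def \<mu>_def)
  have deriv_0: "Y.cgf_deriv 0 0 = 0" "Y.cgf_deriv 1 0 = 0" "Y.cgf_deriv 2 0 = v"
    "Y.cgf_deriv 3 0 = expectation (\<lambda>x. Y x ^ 3)"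
    "Y.cgf_deriv 4 0 = expectation (\<lambda>x. Y x ^ 4) - 3 * v\<^sup>2"
    using mean_0 var
    by (simp_all add: Y.cgf_deriv_def Y.cgf_def Y.tilted_moment_def Y.tilted_mean_0 prob_space)

  have cumulants: "cumulant 3 X = Y.cgf_deriv 3 0" "cumulant 4 X = Y.cgf_deriv 4 0"
  proof -
    have "expectation (\<lambda>x. exp (t * X x)) = exp (t * \<mu>) * Y.tilted_moment 0 t" for t
      unfolding Y.tilted_moment_def
      by (subst integral_mult_right_zero[symmetric])
         (simp add: Y_def algebra_simps flip: exp_add)
    then have D0: "(\<lambda>t. ln (expectation (\<lambda>x. exp (t * X x)))) = (\<lambda>t. t * \<mu> + Y.cgf t)"
      using Y.tilted_moment_0_pos by (auto simp: Y.cgf_def ln_mult less_imp_neq[symmetric])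
    have D1: "deriv (\<lambda>t. t * \<mu> + Y.cgf t) = (\<lambda>t. \<mu> + Y.cgf_deriv 1 t)"
      by (intro ext DERIV_imp_deriv)
         (auto simp: Y.cgf_deriv_def intro!: derivative_eq_intros Y.cgf_has_derivative)
    have D2: "deriv (\<lambda>t. \<mu> + Y.cgf_deriv 1 t) = Y.cgf_deriv 2"
      using Y.cgf_deriv_has_derivative[of 1]
      by (intro ext DERIV_imp_deriv) (auto intro!: derivative_eq_intros simp: numeral_2_eq_2)
    have D3: "deriv (Y.cgf_deriv 2) = Y.cgf_deriv 3" "deriv (Y.cgf_deriv 3) = Y.cgf_deriv 4"
      using Y.cgf_deriv_has_derivative[of 2] Y.cgf_deriv_has_derivative[of 3]
      by (auto intro!: ext DERIV_imp_deriv)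
    have iter: "(deriv ^^ 3) f = deriv (deriv (deriv f))"
      "(deriv ^^ 4) f = deriv (deriv (deriv (deriv f)))" for f :: "real \<Rightarrow> real"
      by (simp_all add: eval_nat_numeral)
    show "cumulant 3 X = Y.cgf_deriv 3 0" "cumulant 4 X = Y.cgf_deriv 4 0"
      unfolding cumulant_def iter D0 D1 D2 D3 by (rule refl)+
  qed

  have cgf_le: "Y.cgf t \<le> t\<^sup>2 * v / 2" for t
  proof (cases "v = 0")
    \<comment> \<open>An almost surely constant variable: 0 is not a proxy variance, since these are positive,
      but the bound still holds because \<open>Y\<close> vanishes almost surely.\<close>
    case True
    have "AE x in M. Y x ^ 2 = 0"
      using var True Y.integrable_tilted[of 2 0]
      by (intro integral_nonneg_eq_0_iff_AE[THEN iffD1]) auto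
    then have "Y.tilted_moment 0 t = expectation (\<lambda>x. 1)"
      unfolding Y.tilted_moment_def by (intro integral_cong_AE) auto
    then show ?thesis
      by (simp add: Y.cgf_def True prob_space)
  next
    case False
    moreover obtain s where s: "sub_gaussian s X" and opt: "optimal_proxy_variance X = v"
      using assms(4) by (auto simp: strictly_sub_gaussian_def v_def)
    moreover have "0 \<le> v"
      by (simp add: v_def)
    ultimately have "sub_gaussian v X"
      using optimal_proxy_variance_attained[OF s] by simp
    then have "Y.tilted_moment 0 t \<le> exp (t\<^sup>2 * v / 2)"
      unfolding Y.tilted_moment_def by (simp add: sub_gaussian_def Y_def \<mu>_def)
    then have "Y.cgf t \<le> ln (exp (t\<^sup>2 * v / 2))"
      unfolding Y.cgf_def using Y.tilted_moment_0_pos by (subst ln_le_cancel_iff) auto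
    then show ?thesis by simp
  qed

  \<comment> \<open>\<open>Q m\<close> is the \<open>m\<close>-th derivative of the parabola, and \<open>D m\<close> that of \<open>g\<close> for \<open>m \<le> 4\<close>.\<close>
  define Q :: "nat \<Rightarrow> real \<Rightarrow> real" where
    "Q = (\<lambda>m t. if m = 0 then t\<^sup>2 * v / 2 else if m = 1 then t * v else if m = 2 then v else 0)"
  define D where "D = (\<lambda>m t. Q m t - Y.cgf_deriv m t)"
  have D_deriv: "(D m has_real_derivative D (Suc m) t) (at t)" if "m < 4" for m t
  proof -
    have "m = 0 \<or> m = 1 \<or> m = 2 \<or> m = 3"
      using that by linarith
    then have "(Q m has_real_derivative Q (Suc m) t) (at t)"
      by (auto simp: Q_def intro!: derivative_eq_intros)
    then show ?thesis
      unfolding D_def by (intro DERIV_diff Y.cgf_deriv_has_derivative that)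
  qed
  have D_nonneg: "0 \<le> D 0 t" for t
    using cgf_le[of t] by (simp add: D_def Q_def Y.cgf_deriv_def)
  have D_0: "D 0 0 = 0" "D 1 0 = 0" "D 2 0 = 0" "D 3 0 = - Y.cgf_deriv 3 0"
    "D 4 0 = - Y.cgf_deriv 4 0"
    using deriv_0 by (simp_all add: D_def Q_def)
  have "0 \<le> D 3 0 * s ^ 3" for s
  proof (rule leading_derivative_nonneg_on_ray)
    show "isCont (D 3) 0"
      using D_deriv[of 3 0] by (intro DERIV_isCont) simp
    fix m :: nat assume "m < 3"
    then have "m = 0 \<or> m = 1 \<or> m = 2" by linarith
    then show "D m 0 = 0" using D_0 by auto
  qed (use D_deriv D_nonneg in auto)
  \<comment> \<open>The order 3 is odd, so approaching 0 from both sides gives opposite inequalities.\<close>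
  from this[of 1] this[of "- 1"] have D3: "D 3 0 = 0"
    by simp
  have "0 \<le> D 4 0 * 1 ^ 4"
  proof (rule leading_derivative_nonneg_on_ray)
    have "isCont (Y.cgf_deriv 4) 0"
      by (auto simp: Y.cgf_deriv_def intro!: DERIV_isCont derivative_eq_intros)
    then show "isCont (D 4) 0"
      by (simp add: D_def Q_def)
    fix m :: nat assume "m < 4"
    then have "m = 0 \<or> m = 1 \<or> m = 2 \<or> m = 3" by linarith
    then show "D m 0 = 0" using D_0 D3 by auto
  qed (use D_deriv D_nonneg in auto)
  then have "Y.cgf_deriv 3 0 = 0" "Y.cgf_deriv 4 0 \<le> 0"
    using D3 D_0 by auto
  then show ?thesis
    using cumulants deriv_0(4,5) by (simp add: Y_def v_def \<mu>_def)
qed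

end
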